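(* The variety $\mathsf{V}(TR_6)$ is exactly the class of all commutative ai-semirings satisfying the identities $$x\preceq y^2,\qquad x\preceq xy,\qquad x^2\approx x_1x_2x_3,$$ together with, for every integer $n\ge 1$, the inequality $$\sigma_n:\quad x\preceq x_1x_2+x_2x_3+\cdots+x_{2n}x_{2n+1}+x_{2n+1}x_1 .$$
   Context: An additively idempotent semiring (ai-semiring) is an algebra $(S,+,\cdot)$ such that $(S,+)$ is a commutative idempotent semigroup, $(S,\cdot)$ is a semigroup, and $x(y+z)\approx xy+xz$, $(x+y)z\approx xz+yz$ hold; it is commutative if $xy\approx yx$ holds. $\mathsf{V}(A)$ denotes the variety generated by $A$, i.e. the smallest class of ai-semirings containing $A$ and closed under subalgebras, homomorphic images and arbitrary direct products. For terms $\mathbf u,\mathbf v$, the inequality $\mathbf u\preceq\mathbf v$ denotes the identity $\mathbf v\approx\mathbf v+\mathbf u$. Letters $x,y,x_1,x_2,\dots$ are distinct variables. $TR_6$ is the ai-semiring on $\{1,2,3,4,5,6\}$ with the following operations. Addition is commutative and idempotent, with $1+a=1$ for all $a$, $2+5=2$, $4+6=4$, and every other sum of two distinct elements of $\{2,3,4,5,6\}$ equal to $3$. Multiplication is commutative, with $2\cdot 6=4\cdot 5=5\cdot 6=3$ and every other product equal to $1$. *)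

theory Defs
  imports "HOL-Algebra.Congruence" "HOL-Library.FuncSet"
begin

section \<open>Additively idempotent semirings\<close>

record 'a ai_alg = "'a partial_object" +
  ai_add :: "'a \<Rightarrow> 'a \<Rightarrow> 'a"
  ai_mult :: "'a \<Rightarrow> 'a \<Rightarrow> 'a"

text \<open>Neither a zero nor a unit is required; as usual for algebras, the carrier is nonempty.\<close>

locale ai_semiring =
  fixes S :: "'a ai_alg"
  assumes nonempty: "carrier S \<noteq> {}"
    and add_closed: "\<lbrakk>x \<in> carrier S; y \<in> carrier S\<rbrakk> \<Longrightarrow> ai_add S x y \<in> carrier S"
    and mult_closed: "\<lbrakk>x \<in> carrier S; y \<in> carrier S\<rbrakk> \<Longrightarrow> ai_mult S x y \<in> carrier S"
    and add_assoc: "\<lbrakk>x \<in> carrier S; y \<in> carrier S; z \<in> carrier S\<rbrakk> \<Longrightarrow>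
      ai_add S (ai_add S x y) z = ai_add S x (ai_add S y z)"
    and add_comm: "\<lbrakk>x \<in> carrier S; y \<in> carrier S\<rbrakk> \<Longrightarrow> ai_add S x y = ai_add S y x"
    and add_idem: "x \<in> carrier S \<Longrightarrow> ai_add S x x = x"
    and mult_assoc: "\<lbrakk>x \<in> carrier S; y \<in> carrier S; z \<in> carrier S\<rbrakk> \<Longrightarrow>
      ai_mult S (ai_mult S x y) z = ai_mult S x (ai_mult S y z)"
    and distrib_left: "\<lbrakk>x \<in> carrier S; y \<in> carrier S; z \<in> carrier S\<rbrakk> \<Longrightarrow>
      ai_mult S x (ai_add S y z) = ai_add S (ai_mult S x y) (ai_mult S x z)"
    and distrib_right: "\<lbrakk>x \<in> carrier S; y \<in> carrier S; z \<in> carrier S\<rbrakk> \<Longrightarrow>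
      ai_mult S (ai_add S x y) z = ai_add S (ai_mult S x z) (ai_mult S y z)"

locale comm_ai_semiring = ai_semiring +
  assumes mult_comm: "\<lbrakk>x \<in> carrier S; y \<in> carrier S\<rbrakk> \<Longrightarrow> ai_mult S x y = ai_mult S y x"

section \<open>Homomorphisms, subalgebras and products\<close>

definition ai_hom :: "'a ai_alg \<Rightarrow> 'b ai_alg \<Rightarrow> ('a \<Rightarrow> 'b) set" where
  "ai_hom S T = {h. h \<in> carrier S \<rightarrow> carrier T \<and>
     (\<forall>x\<in>carrier S. \<forall>y\<in>carrier S.
        h (ai_add S x y) = ai_add T (h x) (h y) \<and> h (ai_mult S x y) = ai_mult T (h x) (h y))}"

definition ai_iso :: "'a ai_alg \<Rightarrow> 'b ai_alg \<Rightarrow> bool" where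
  "ai_iso S T \<longleftrightarrow> (\<exists>h\<in>ai_hom S T. bij_betw h (carrier S) (carrier T))"

definition ai_subuniverse :: "'a set \<Rightarrow> 'a ai_alg \<Rightarrow> bool" where
  "ai_subuniverse B S \<longleftrightarrow> B \<noteq> {} \<and> B \<subseteq> carrier S \<and>
     (\<forall>x\<in>B. \<forall>y\<in>B. ai_add S x y \<in> B \<and> ai_mult S x y \<in> B)"

definition ai_prod :: "'i set \<Rightarrow> ('i \<Rightarrow> 'a ai_alg) \<Rightarrow> ('i \<Rightarrow> 'a) ai_alg" where
  "ai_prod I F = \<lparr>carrier = (\<Pi>\<^sub>E i\<in>I. carrier (F i)),
     ai_add = (\<lambda>f g. \<lambda>i\<in>I. ai_add (F i) (f i) (g i)),
     ai_mult = (\<lambda>f g. \<lambda>i\<in>I. ai_mult (F i) (f i) (g i))\<rparr>"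

section \<open>The variety generated by an algebra\<close>

text \<open>
  A class of algebras is rendered as a set of algebras whose carriers are subsets of a type
  \<open>'u\<close>, the universe. Algebras are taken up to isomorphism: closure under products means
  that every algebra over \<open>'u\<close> isomorphic to a product of members is a member.
  Index sets inside \<open>'u\<close> suffice. If a product is isomorphic to an algebra over \<open>'u\<close>, the
  set J of indices with nontrivial factors satisfies \<open>2^|J| \<le> |'u|\<close>, and dropping the trivial
  factors does not change the product up to isomorphism.
\<close>

definition closed_sub :: "'u ai_alg set \<Rightarrow> bool" where
  "closed_sub K \<longleftrightarrow> (\<forall>S\<in>K. \<forall>B. ai_subuniverse B S \<longrightarrow> S\<lparr>carrier := B\<rparr> \<in> K)"

definition closed_hom_image :: "'u ai_alg set \<Rightarrow> bool" where
  "closed_hom_image K \<longleftrightarrow>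
     (\<forall>S\<in>K. \<forall>T. \<forall>h\<in>ai_hom S T. h ` carrier S = carrier T \<longrightarrow> T \<in> K)"

definition closed_prod :: "'u ai_alg set \<Rightarrow> bool" where
  "closed_prod K \<longleftrightarrow>
     (\<forall>(I :: 'u set) F. (\<forall>i\<in>I. F i \<in> K) \<longrightarrow> (\<forall>T. ai_iso (ai_prod I F) T \<longrightarrow> T \<in> K))"

definition variety :: "'b ai_alg \<Rightarrow> 'u ai_alg set" where
  "variety A = \<Inter>{K. K \<subseteq> Collect ai_semiring \<and>
      (\<forall>S. ai_semiring S \<and> ai_iso A S \<longrightarrow> S \<in> K) \<and>
      closed_sub K \<and> closed_hom_image K \<and> closed_prod K}"

text \<open>
  In a universe that is too small, products needed to reach an algebra may be missing: over a
  countable type, for instance, all nontrivial products are essentially finite. Membership of an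
  algebra over \<open>'a\<close> in the (proper) class generated by a countable algebra A is therefore
  decided in a universe having room for the power of A indexed by all assignments of elements of A
  to variables from \<open>'a\<close>; that power contains the relatively free algebra over \<open>'a\<close>.
\<close>

definition large_universe :: "'a itself \<Rightarrow> 'u itself \<Rightarrow> bool" where
  "large_universe _ _ \<longleftrightarrow> (\<exists>e :: (('a \<Rightarrow> nat) \<Rightarrow> nat) \<Rightarrow> 'u. inj e)"

lemma large_universe_exists: "large_universe TYPE('a) TYPE(('a \<Rightarrow> nat) \<Rightarrow> nat)"
  unfolding large_universe_def by (rule exI[of _ id]) simp

section \<open>Terms and identities\<close>

datatype ai_term = Var nat | Add ai_term ai_term | Mult ai_term ai_term

primrec ai_eval :: "'a ai_alg \<Rightarrow> (nat \<Rightarrow> 'a) \<Rightarrow> ai_term \<Rightarrow> 'a" where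
  "ai_eval S \<rho> (Var i) = \<rho> i"
| "ai_eval S \<rho> (Add u v) = ai_add S (ai_eval S \<rho> u) (ai_eval S \<rho> v)"
| "ai_eval S \<rho> (Mult u v) = ai_mult S (ai_eval S \<rho> u) (ai_eval S \<rho> v)"

definition sat_eq :: "'a ai_alg \<Rightarrow> ai_term \<Rightarrow> ai_term \<Rightarrow> bool" where
  "sat_eq S u v \<longleftrightarrow> (\<forall>\<rho>. range \<rho> \<subseteq> carrier S \<longrightarrow> ai_eval S \<rho> u = ai_eval S \<rho> v)"

definition sat_le :: "'a ai_alg \<Rightarrow> ai_term \<Rightarrow> ai_term \<Rightarrow> bool" where
  "sat_le S u v \<longleftrightarrow> sat_eq S v (Add v u)"

text \<open>
  \<open>Var i\<close> plays the role of $x_i$, and \<open>Var 0\<close> that of $x$. For \<open>n \<ge> 1\<close>, the following term is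
  $x_1x_2 + x_2x_3 + \cdots + x_{2n}x_{2n+1} + x_{2n+1}x_1$, bracketed to the left.
\<close>

definition odd_cycle :: "nat \<Rightarrow> ai_term" where
  "odd_cycle n = foldl Add (Mult (Var 1) (Var 2))
     (map (\<lambda>i. Mult (Var i) (Var (i + 1))) [2..<2 * n + 1] @ [Mult (Var (2 * n + 1)) (Var 1)])"

definition sat_sigma :: "'a ai_alg \<Rightarrow> nat \<Rightarrow> bool" where
  "sat_sigma S n \<longleftrightarrow> sat_le S (Var 0) (odd_cycle n)"

section \<open>The semiring TR6\<close>

definition TR6 :: "nat ai_alg" where
  "TR6 = \<lparr>carrier = {1..6},
     ai_add = (\<lambda>a b. if a = b then a
       else if a = 1 \<or> b = 1 then 1
       else if {a, b} = {2, 5} then 2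
       else if {a, b} = {4, 6} then 4
       else 3),
     ai_mult = (\<lambda>a b. if {a, b} \<in> {{2, 6}, {4, 5}, {5, 6}} then 3 else 1)\<rparr>"

lemma comm_ai_semiring_TR6: "comm_ai_semiring TR6"
proof -
  have add: "ai_add TR6 a b = (if a = b then a else if a = 1 \<or> b = 1 then 1
      else if a = 2 \<and> b = 5 \<or> a = 5 \<and> b = 2 then 2
      else if a = 4 \<and> b = 6 \<or> a = 6 \<and> b = 4 then 4 else 3)" for a b
    by (simp add: TR6_def doubleton_eq_iff)
  have mult: "ai_mult TR6 a b = (if a = 2 \<and> b = 6 \<or> a = 6 \<and> b = 2 \<or> a = 4 \<and> b = 5 \<or>
      a = 5 \<and> b = 4 \<or> a = 5 \<and> b = 6 \<or> a = 6 \<and> b = 5 then 3 else 1)" for a b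
    by (simp add: TR6_def doubleton_eq_iff)
  have carrier: "carrier TR6 = {1, 2, 3, 4, 5, 6}"
    by (auto simp: TR6_def)
  have "\<forall>x\<in>carrier TR6. \<forall>y\<in>carrier TR6.
      ai_add TR6 x y \<in> carrier TR6 \<and> ai_mult TR6 x y \<in> carrier TR6 \<and>
      ai_add TR6 x y = ai_add TR6 y x \<and> ai_mult TR6 x y = ai_mult TR6 y x \<and>
      ai_add TR6 x x = x"
    unfolding carrier by (simp add: add mult)
  moreover have "\<forall>x\<in>carrier TR6. \<forall>y\<in>carrier TR6. \<forall>z\<in>carrier TR6.
      ai_add TR6 (ai_add TR6 x y) z = ai_add TR6 x (ai_add TR6 y z) \<and>
      ai_mult TR6 (ai_mult TR6 x y) z = ai_mult TR6 x (ai_mult TR6 y z) \<and>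
      ai_mult TR6 x (ai_add TR6 y z) = ai_add TR6 (ai_mult TR6 x y) (ai_mult TR6 x z) \<and>
      ai_mult TR6 (ai_add TR6 x y) z = ai_add TR6 (ai_mult TR6 x z) (ai_mult TR6 y z)"
    unfolding carrier by (simp add: add mult)
  moreover have "carrier TR6 \<noteq> {}"
    by (simp add: carrier)
  ultimately show ?thesis
    by unfold_locales blast+
qed

end

theory Submission
  imports Defs "HOL-Library.Countable_Set"
begin

text \<open>
  Two facts combine. The first is Birkhoff's theorem: up to isomorphism, the variety generated by
  \<open>A\<close> consists of the algebras that satisfy every identity of \<open>A\<close> (\<open>birkhoff_ai_variety\<close>). The
  second is that the listed axioms are a basis of the identities of TR6 (\<open>ai_models_TR6_iff\<close>).

  For Birkhoff's theorem, the algebras satisfying all identities of \<open>A\<close> are closed under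
  subalgebras, homomorphic images and products, so they contain the variety. Conversely, let \<open>S\<close>
  satisfy these identities. In the power of \<open>A\<close> indexed by all maps from \<open>S\<close> to \<open>A\<close>, each
  element of \<open>S\<close> gives the point that evaluates the maps at it, and these points generate a
  relatively free subalgebra. Sending the value of a term at such points to its value at the
  corresponding elements of \<open>S\<close> is well defined, because two terms with the same value form an
  identity of \<open>A\<close>; this makes \<open>S\<close> a homomorphic image.

  For the basis, write \<open>a \<le> b\<close> for \<open>b + a = b\<close>. Every term is a sum of monomials, so it suffices
  to derive from the axioms that a monomial \<open>m\<close> of \<open>u\<close> is below \<open>v\<close> when \<open>u \<preceq> v\<close> holds in TR6.
  The axioms make squares and products of three factors the greatest element. Regard the
  monomials of \<open>v\<close> of the form \<open>xy\<close> as the edges of a graph. If \<open>v\<close> has a longer monomial or the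
  graph has an odd closed walk, then the axioms, in particular the \<open>\<sigma>\<^sub>n\<close>, make \<open>v\<close> greatest.
  Otherwise the graph has a proper 2-colouring. In TR6 the only value not below 3 is the greatest
  element 1. Assign 5 and 6 to the vertices according to colour, 3 to the remaining variables that
  occur as summands, and 1 to all others. Then \<open>v\<close> is below 3, hence so is \<open>m\<close>. This forces \<open>m\<close> to
  be a variable occurring in \<open>v\<close>, in which case \<open>x \<preceq> xy\<close> puts it below \<open>v\<close>, or a product
  \<open>yz\<close> of two vertices of different colours. In the latter case \<open>yz\<close> is an edge: in TR6 the
  products 2 6 and 4 5 are 3, like 5 6, but 2 4 is 1. If \<open>yz\<close> were not an edge, then replacing the
  values 5 and 6 of \<open>y\<close> and \<open>z\<close> by 2 and 4 would keep \<open>v\<close> below 3 and turn \<open>yz\<close> into 1.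
\<close>

section \<open>Evaluation of terms\<close>

definition ai_algebra :: "'a ai_alg \<Rightarrow> bool" where
  "ai_algebra S \<longleftrightarrow> carrier S \<noteq> {} \<and>
     (\<forall>x\<in>carrier S. \<forall>y\<in>carrier S. ai_add S x y \<in> carrier S \<and> ai_mult S x y \<in> carrier S)"

lemma (in ai_semiring) is_ai_algebra: "ai_algebra S"
  using nonempty add_closed mult_closed unfolding ai_algebra_def by blast

lemma ai_eval_closed:
  assumes "ai_algebra S" "range \<rho> \<subseteq> carrier S"
  shows "ai_eval S \<rho> t \<in> carrier S"
  using assms by (induction t) (auto simp: ai_algebra_def)

lemma ai_eval_carrier_update [simp]: "ai_eval (S\<lparr>carrier := B\<rparr>) \<rho> t = ai_eval S \<rho> t"
  by (induction t) auto

primrec ai_vars :: "ai_term \<Rightarrow> nat set" where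
  "ai_vars (Var i) = {i}"
| "ai_vars (Add u v) = ai_vars u \<union> ai_vars v"
| "ai_vars (Mult u v) = ai_vars u \<union> ai_vars v"

primrec ai_rename :: "(nat \<Rightarrow> nat) \<Rightarrow> ai_term \<Rightarrow> ai_term" where
  "ai_rename r (Var i) = Var (r i)"
| "ai_rename r (Add u v) = Add (ai_rename r u) (ai_rename r v)"
| "ai_rename r (Mult u v) = Mult (ai_rename r u) (ai_rename r v)"

lemma finite_ai_vars: "finite (ai_vars t)"
  by (induction t) auto

lemma ai_vars_nonempty: "ai_vars t \<noteq> {}"
  by (induction t) auto

lemma ai_eval_rename: "ai_eval S \<rho> (ai_rename r t) = ai_eval S (\<rho> \<circ> r) t"
  by (induction t) auto

lemma ai_eval_cong: "(\<And>i. i \<in> ai_vars t \<Longrightarrow> \<rho> i = \<tau> i) \<Longrightarrow> ai_eval S \<rho> t = ai_eval S \<tau> t"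
  by (induction t) auto

lemma ai_eval_hom:
  assumes "h \<in> ai_hom S T" "ai_algebra S" "range \<rho> \<subseteq> carrier S"
  shows "h (ai_eval S \<rho> t) = ai_eval T (h \<circ> \<rho>) t"
  using assms ai_eval_closed[OF assms(2,3)] by (induction t) (auto simp: ai_hom_def)

lemma ai_hom_comp:
  assumes "g \<in> ai_hom S T" "h \<in> ai_hom T U"
  shows "h \<circ> g \<in> ai_hom S U"
  using assms by (auto simp: ai_hom_def Pi_iff)

lemma ai_prod_proj_hom: "i \<in> I \<Longrightarrow> (\<lambda>f. f i) \<in> ai_hom (ai_prod I F) (F i)"
  by (auto simp: ai_hom_def ai_prod_def)

lemma ai_algebra_prod:
  assumes "\<And>i. i \<in> I \<Longrightarrow> ai_algebra (F i)"
  shows "ai_algebra (ai_prod I F)"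
  using assms by (auto simp: ai_algebra_def ai_prod_def PiE_eq_empty_iff PiE_iff)

lemma ai_algebra_hom_image:
  assumes "h \<in> ai_hom S T" "h ` carrier S = carrier T" "ai_algebra S"
  shows "ai_algebra T"
proof -
  have "ai_add T x y \<in> carrier T \<and> ai_mult T x y \<in> carrier T"
    if xy: "x \<in> carrier T" "y \<in> carrier T" for x y
  proof -
    obtain a b where "a \<in> carrier S" "b \<in> carrier S" "x = h a" "y = h b"
      using xy unfolding assms(2)[symmetric] by blast
    moreover from this have "ai_add S a b \<in> carrier S" "ai_mult S a b \<in> carrier S"
      using assms(3) by (auto simp: ai_algebra_def)
    ultimately have "ai_add T x y = h (ai_add S a b)" "ai_mult T x y = h (ai_mult S a b)"
      and "ai_add S a b \<in> carrier S" "ai_mult S a b \<in> carrier S"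
      using assms(1) by (simp_all add: ai_hom_def)
    then show ?thesis unfolding assms(2)[symmetric] by simp
  qed
  then show ?thesis using assms(2,3) by (auto simp: ai_algebra_def)
qed

section \<open>Identities and the operators H, S and P\<close>

text \<open>
  The carrier types of \<open>A\<close> and of its models differ, so that the class can be formed in every
  universe. When \<open>A\<close> is an ai-semiring, the laws of ai-semirings are among the identities
  inherited.
\<close>

definition ai_models :: "'b ai_alg \<Rightarrow> 'a ai_alg set" where
  "ai_models A = {T. ai_algebra T \<and> (\<forall>u v. sat_eq A u v \<longrightarrow> sat_eq T u v)}"

lemma sat_eq_hom_image:
  assumes "h \<in> ai_hom S T" "h ` carrier S = carrier T" "ai_algebra S" "sat_eq S u v"
  shows "sat_eq T u v"
  unfolding sat_eq_def
proof (intro allI impI)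
  fix \<rho> :: "nat \<Rightarrow> 'b" assume \<rho>: "range \<rho> \<subseteq> carrier T"
  define \<tau> where "\<tau> = inv_into (carrier S) h \<circ> \<rho>"
  have \<tau>: "range \<tau> \<subseteq> carrier S" and h: "h \<circ> \<tau> = \<rho>"
    using \<rho> assms(2) by (auto simp: \<tau>_def inv_into_into subset_iff f_inv_into_f fun_eq_iff)
  have "ai_eval T \<rho> w = h (ai_eval S \<tau> w)" for w
    using ai_eval_hom[OF assms(1,3) \<tau>] h by simp
  then show "ai_eval T \<rho> u = ai_eval T \<rho> v"
    using assms(4) \<tau> by (simp add: sat_eq_def)
qed

lemma sat_eq_prod:
  assumes "\<And>i. i \<in> I \<Longrightarrow> ai_algebra (F i)" "\<And>i. i \<in> I \<Longrightarrow> sat_eq (F i) u v"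
  shows "sat_eq (ai_prod I F) u v"
  unfolding sat_eq_def
proof (intro allI impI)
  fix \<rho> :: "nat \<Rightarrow> 'a \<Rightarrow> 'b" assume \<rho>: "range \<rho> \<subseteq> carrier (ai_prod I F)"
  note alg = ai_algebra_prod[OF assms(1)]
  have "ai_eval (ai_prod I F) \<rho> w \<in> extensional I" for w
    using ai_eval_closed[OF alg \<rho>, of w] by (auto simp: ai_prod_def PiE_iff)
  moreover have "ai_eval (ai_prod I F) \<rho> u i = ai_eval (ai_prod I F) \<rho> v i" if "i \<in> I" for i
  proof -
    have "range ((\<lambda>f. f i) \<circ> \<rho>) \<subseteq> carrier (F i)"
      using \<rho> that by (auto simp: ai_prod_def PiE_iff subset_iff)
    then show ?thesis
      using ai_eval_hom[OF ai_prod_proj_hom[OF that] alg \<rho>] assms(2)[OF that]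
      by (simp add: sat_eq_def)
  qed
  ultimately show "ai_eval (ai_prod I F) \<rho> u = ai_eval (ai_prod I F) \<rho> v"
    by (meson extensionalityI)
qed

lemma ai_models_hom_image:
  assumes "S \<in> ai_models A" "h \<in> ai_hom S T" "h ` carrier S = carrier T"
  shows "T \<in> ai_models A"
  using assms ai_algebra_hom_image[OF assms(2,3)] sat_eq_hom_image[OF assms(2,3)]
  by (simp add: ai_models_def)

lemma ai_models_iso: "S \<in> ai_models A \<Longrightarrow> ai_iso S T \<Longrightarrow> T \<in> ai_models A"
  by (auto simp: ai_iso_def bij_betw_def intro: ai_models_hom_image)

lemma sat_eq_sub: "B \<subseteq> carrier S \<Longrightarrow> sat_eq S u v \<Longrightarrow> sat_eq (S\<lparr>carrier := B\<rparr>) u v"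
  by (simp add: sat_eq_def subset_trans)

lemma ai_models_sub: "S \<in> ai_models A \<Longrightarrow> ai_subuniverse B S \<Longrightarrow> S\<lparr>carrier := B\<rparr> \<in> ai_models A"
  by (simp add: ai_models_def ai_subuniverse_def ai_algebra_def sat_eq_sub)

lemma ai_models_prod: "(\<And>i. i \<in> I \<Longrightarrow> F i \<in> ai_models A) \<Longrightarrow> ai_prod I F \<in> ai_models A"
  unfolding ai_models_def by (simp add: ai_algebra_prod sat_eq_prod)

lemma sat_eq_three:
  assumes "sat_eq S u v" "x \<in> carrier S" "y \<in> carrier S" "z \<in> carrier S"
  shows "ai_eval S (\<lambda>n. if n = 0 then x else if n = 1 then y else z) u =
    ai_eval S (\<lambda>n. if n = 0 then x else if n = 1 then y else z) v"
  using assms by (auto simp: sat_eq_def image_subset_iff)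

lemma ai_models_ai_semiring:
  assumes "ai_semiring A" "T \<in> ai_models A"
  shows "ai_semiring T"
proof -
  interpret A: ai_semiring A by fact
  let ?x = "Var 0" and ?y = "Var 1" and ?z = "Var 2"
  have T: "sat_eq A u v \<Longrightarrow> sat_eq T u v" for u v
    using assms(2) by (simp add: ai_models_def)
  note T3 = sat_eq_three[OF T]
  have *: "sat_eq A (Add (Add ?x ?y) ?z) (Add ?x (Add ?y ?z))"
    "sat_eq A (Add ?x ?y) (Add ?y ?x)"
    "sat_eq A (Add ?x ?x) ?x"
    "sat_eq A (Mult (Mult ?x ?y) ?z) (Mult ?x (Mult ?y ?z))"
    "sat_eq A (Mult ?x (Add ?y ?z)) (Add (Mult ?x ?y) (Mult ?x ?z))"
    "sat_eq A (Mult (Add ?x ?y) ?z) (Add (Mult ?x ?z) (Mult ?y ?z))"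
    using A.add_assoc A.add_comm A.add_idem A.mult_assoc A.distrib_left A.distrib_right
    by (simp_all add: sat_eq_def image_subset_iff)
  show ?thesis
  proof
    show "carrier T \<noteq> {}" using assms(2) by (simp add: ai_models_def ai_algebra_def)
  next
    fix x y assume xy: "x \<in> carrier T" "y \<in> carrier T"
    then show "ai_add T x y \<in> carrier T" "ai_mult T x y \<in> carrier T"
      using assms(2) by (simp_all add: ai_models_def ai_algebra_def)
    show "ai_add T x y = ai_add T y x" using T3[OF *(2) xy xy(1)] by simp
    show "ai_add T x x = x" using T3[OF *(3) xy xy(1)] by simp
    fix z assume z: "z \<in> carrier T"
    show "ai_add T (ai_add T x y) z = ai_add T x (ai_add T y z)" using T3[OF *(1) xy z] by simp
    show "ai_mult T (ai_mult T x y) z = ai_mult T x (ai_mult T y z)" using T3[OF *(4) xy z] by simp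
    show "ai_mult T x (ai_add T y z) = ai_add T (ai_mult T x y) (ai_mult T x z)"
      using T3[OF *(5) xy z] by simp
    show "ai_mult T (ai_add T x y) z = ai_add T (ai_mult T x z) (ai_mult T y z)"
      using T3[OF *(6) xy z] by simp
  qed
qed

text \<open>
  The easy half of Birkhoff's theorem: the models of the identities of \<open>A\<close> are one of the classes
  whose intersection is the variety.
\<close>

lemma variety_subset_ai_models:
  assumes "ai_semiring A"
  shows "variety A \<subseteq> ai_models A"
proof -
  have A: "A \<in> ai_models A"
    using assms by (simp add: ai_models_def ai_semiring.is_ai_algebra)
  have "ai_models A \<subseteq> Collect ai_semiring"
    using ai_models_ai_semiring[OF assms] by blast
  moreover have "\<forall>S. ai_semiring S \<and> ai_iso A S \<longrightarrow> S \<in> ai_models A"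
    using ai_models_iso[OF A] by blast
  moreover have "closed_sub (ai_models A)"
    unfolding closed_sub_def using ai_models_sub by blast
  moreover have "closed_hom_image (ai_models A)"
    unfolding closed_hom_image_def using ai_models_hom_image by blast
  moreover have "closed_prod (ai_models A)"
    unfolding closed_prod_def by (intro allI impI) (rule ai_models_iso[OF ai_models_prod], auto)
  ultimately show ?thesis unfolding variety_def by (intro Inter_lower CollectI conjI)
qed

lemma variety_base: "ai_semiring S \<Longrightarrow> ai_iso A S \<Longrightarrow> S \<in> variety A"
  unfolding variety_def by blast

lemma variety_sub: "S \<in> variety A \<Longrightarrow> ai_subuniverse B S \<Longrightarrow> S\<lparr>carrier := B\<rparr> \<in> variety A"
  unfolding variety_def closed_sub_def by blast

lemma variety_hom_image:
  fixes S T :: "'u ai_alg"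
  assumes "S \<in> variety A" "h \<in> ai_hom S T" "h ` carrier S = carrier T"
  shows "T \<in> variety A"
proof -
  have "T \<in> K" if "S \<in> K" "closed_hom_image K" for K
    using that assms(2,3) unfolding closed_hom_image_def by blast
  then show ?thesis using assms(1) unfolding variety_def by simp
qed

lemma variety_prod:
  fixes I :: "'u set" and F :: "'u \<Rightarrow> 'u ai_alg" and T :: "'u ai_alg"
  assumes "\<And>i. i \<in> I \<Longrightarrow> F i \<in> variety A" "ai_iso (ai_prod I F) T"
  shows "T \<in> variety A"
proof -
  have "T \<in> K" if "\<And>i. i \<in> I \<Longrightarrow> F i \<in> K" "closed_prod K" for K
    using that assms(2) unfolding closed_prod_def by blast
  then show ?thesis using assms(1) unfolding variety_def by simp
qed

section \<open>Birkhoff's theorem over a large universe\<close>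

definition ai_transport :: "('a \<Rightarrow> 'b) \<Rightarrow> 'a ai_alg \<Rightarrow> 'b ai_alg" where
  "ai_transport f S = \<lparr>carrier = f ` carrier S,
     ai_add = (\<lambda>x y. f (ai_add S (inv_into (carrier S) f x) (inv_into (carrier S) f y))),
     ai_mult = (\<lambda>x y. f (ai_mult S (inv_into (carrier S) f x) (inv_into (carrier S) f y)))\<rparr>"

lemma carrier_ai_transport: "carrier (ai_transport f S) = f ` carrier S"
  by (simp add: ai_transport_def)

lemma ai_transport_hom: "inj_on f (carrier S) \<Longrightarrow> f \<in> ai_hom S (ai_transport f S)"
  by (auto simp: ai_hom_def ai_transport_def)

lemma ai_transport_inv_hom:
  "inj_on f (carrier S) \<Longrightarrow> ai_algebra S \<Longrightarrow>
    inv_into (carrier S) f \<in> ai_hom (ai_transport f S) S"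
  by (auto simp: ai_hom_def ai_transport_def ai_algebra_def)

lemma ai_iso_transport: "inj_on f (carrier S) \<Longrightarrow> ai_iso S (ai_transport f S)"
  unfolding ai_iso_def using ai_transport_hom inj_on_imp_bij_betw carrier_ai_transport by metis

lemma ai_iso_transport_sym: "inj_on f (carrier S) \<Longrightarrow> ai_algebra S \<Longrightarrow> ai_iso (ai_transport f S) S"
  unfolding ai_iso_def using ai_transport_inv_hom
  by (metis carrier_ai_transport bij_betw_inv_into inj_on_imp_bij_betw)

text \<open>
  The power of \<open>A\<close> indexed by the assignments \<open>P\<close> has functions on \<open>P\<close> as elements, but the variety
  only knows index sets and carriers inside \<open>'u\<close>. The injection \<open>e\<close> makes room for both: an
  assignment is coded by its characteristic function, an element of \<open>A\<close> by a constant
  function, and an element of the power by the function it is.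
\<close>

lemma power_in_variety:
  fixes A :: "nat ai_alg"
  assumes A: "ai_semiring A" and e: "inj (e :: (('a \<Rightarrow> nat) \<Rightarrow> nat) \<Rightarrow> 'u)"
  defines "P \<equiv> {\<rho> :: 'a \<Rightarrow> nat. range \<rho> \<subseteq> carrier A}"
  obtains T :: "'u ai_alg" and pr where "T \<in> variety A"
    "\<forall>\<rho>\<in>P. pr \<rho> \<in> ai_hom T A"
    "\<forall>f\<in>P \<rightarrow> carrier A. \<exists>x\<in>carrier T. \<forall>\<rho>\<in>P. pr \<rho> x = f \<rho>"
proof -
  define k where "k n = e (\<lambda>_. n)" for n
  define j where "j \<rho> = e (\<lambda>\<rho>'. if \<rho>' = \<rho> then 1 else 0)" for \<rho>
  have k: "inj k" using e by (auto simp: inj_def k_def fun_eq_iff)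
  have j: "inj j"
  proof (rule injI)
    fix \<rho> \<rho>' assume "j \<rho> = j \<rho>'"
    then have "(\<lambda>\<tau>. if \<tau> = \<rho> then 1 else 0::nat) = (\<lambda>\<tau>. if \<tau> = \<rho>' then 1 else 0)"
      using e by (simp add: j_def inj_eq)
    from fun_cong[OF this, of \<rho>] show "\<rho> = \<rho>'" by (auto split: if_splits)
  qed
  have algA: "ai_algebra A" by (rule ai_semiring.is_ai_algebra[OF A])
  have kA: "inj_on k (carrier A)" using k by (rule inj_on_subset) simp
  define A' where "A' = ai_transport k A"
  have isoA': "ai_iso A A'" unfolding A'_def by (rule ai_iso_transport[OF kA])
  have "A \<in> ai_models A" using algA by (simp add: ai_models_def)
  then have mA': "A' \<in> ai_models A" using isoA' by (rule ai_models_iso)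
  then have algA': "ai_algebra A'" by (simp add: ai_models_def)
  have A': "A' \<in> variety A"
    using variety_base isoA' ai_models_ai_semiring[OF A mA'] by blast
  define Q where "Q = ai_prod (j ` P) (\<lambda>_. A')"
  have algQ: "ai_algebra Q" unfolding Q_def by (rule ai_algebra_prod) (rule algA')
  have carrierQ: "carrier Q = j ` P \<rightarrow>\<^sub>E k ` carrier A"
    by (simp add: Q_def ai_prod_def A'_def carrier_ai_transport)
  define enc where "enc \<phi> = e (\<lambda>\<rho>. if \<rho> \<in> P then inv k (\<phi> (j \<rho>)) else 0)" for \<phi>
  have enc: "inj_on enc (carrier Q)"
  proof (rule inj_onI)
    fix \<phi> \<psi> assume \<phi>: "\<phi> \<in> carrier Q" and \<psi>: "\<psi> \<in> carrier Q" and "enc \<phi> = enc \<psi>"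
    then have eq: "(\<lambda>\<rho>. if \<rho> \<in> P then inv k (\<phi> (j \<rho>)) else 0) =
        (\<lambda>\<rho>. if \<rho> \<in> P then inv k (\<psi> (j \<rho>)) else 0)"
      using e by (simp add: enc_def inj_eq)
    have "\<phi> i = \<psi> i" if i: "i \<in> j ` P" for i
    proof -
      have "inv k (\<phi> i) = inv k (\<psi> i)"
        using i fun_cong[OF eq] by (auto split: if_splits) metis
      moreover have "\<phi> i \<in> range k" "\<psi> i \<in> range k"
        using \<phi> \<psi> i by (auto simp: carrierQ dest!: PiE_mem)
      ultimately show ?thesis by (rule inv_into_injective)
    qed
    then show "\<phi> = \<psi>" using \<phi> \<psi> unfolding carrierQ by (meson PiE_ext)
  qed
  define T where "T = ai_transport enc Q"
  define pr where "pr \<rho> = inv_into (carrier A) k \<circ> ((\<lambda>\<phi>. \<phi> (j \<rho>)) \<circ> inv_into (carrier Q) enc)" for \<rho>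
  have pr_enc: "pr \<rho> (enc \<phi>) = inv_into (carrier A) k (\<phi> (j \<rho>))" if "\<phi> \<in> carrier Q" for \<rho> \<phi>
    using that enc by (simp add: pr_def)
  show thesis
  proof (rule that[of T pr]; (intro ballI impI)?)
    show "T \<in> variety A"
      unfolding T_def using A' variety_prod[of "j ` P" "\<lambda>_. A'"] ai_iso_transport[OF enc]
      by (auto simp: Q_def)
  next
    fix \<rho> assume "\<rho> \<in> P"
    then have "(\<lambda>\<phi>. \<phi> (j \<rho>)) \<in> ai_hom Q A'"
      unfolding Q_def using ai_prod_proj_hom[of "j \<rho>" "j ` P" "\<lambda>_. A'"] by blast
    then show "pr \<rho> \<in> ai_hom T A"
      unfolding pr_def T_def
      by (intro ai_hom_comp[OF ai_hom_comp[OF ai_transport_inv_hom[OF enc algQ]]])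
        (auto simp: A'_def ai_transport_inv_hom[OF kA algA])
  next
    fix f assume f: "f \<in> P \<rightarrow> carrier A"
    define \<phi> where "\<phi> = (\<lambda>i\<in>j ` P. k (f (inv j i)))"
    have \<phi>: "\<phi> \<in> carrier Q" using f j by (auto simp: \<phi>_def carrierQ)
    have "pr \<rho> (enc \<phi>) = f \<rho>" if "\<rho> \<in> P" for \<rho>
    proof -
      have "\<phi> (j \<rho>) = k (f \<rho>)" "f \<rho> \<in> carrier A" using that f j by (auto simp: \<phi>_def)
      then show ?thesis using kA by (simp add: pr_enc[OF \<phi>])
    qed
    then show "\<exists>x\<in>carrier T. \<forall>\<rho>\<in>P. pr \<rho> x = f \<rho>"
      using \<phi> by (auto simp: T_def carrier_ai_transport)
  qed
qed

text \<open>
  Two terms evaluated under different assignments can be seen as evaluated under one: name the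
  finitely many values involved by numbers and rename each variable to the name of its value.
  Variables of the two terms that carry the same value thereby become the same variable, which is
  what turns an equality over all maps into an identity.
\<close>

lemma common_assignment:
  assumes "range \<sigma> \<subseteq> C" "range \<sigma>' \<subseteq> C"
  obtains \<tau> :: "nat \<Rightarrow> 'a" and c :: "'a \<Rightarrow> nat" where "range \<tau> \<subseteq> C"
    "\<forall>i\<in>ai_vars t. \<tau> (c (\<sigma> i)) = \<sigma> i" "\<forall>i\<in>ai_vars t'. \<tau> (c (\<sigma>' i)) = \<sigma>' i"
proof -
  define W where "W = \<sigma> ` ai_vars t \<union> \<sigma>' ` ai_vars t'"
  have W: "countable W" "W \<noteq> {}" "W \<subseteq> C"
    using assms finite_ai_vars ai_vars_nonempty by (auto simp: W_def intro: countable_finite)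
  show thesis
  proof (rule that[of "from_nat_into W" "to_nat_on W"])
    show "range (from_nat_into W) \<subseteq> C" using from_nat_into[OF W(2)] W(3) by auto
  qed (use W(1) in \<open>auto simp: W_def\<close>)
qed

text \<open>
  The hard half of Birkhoff's theorem. \<open>B\<close> is the subalgebra of the power generated by the points
  \<open>p s\<close>, and \<open>H\<close> maps it onto \<open>S\<close> by sending \<open>p s\<close> to \<open>s\<close>.
\<close>

theorem ai_model_in_variety:
  fixes A :: "nat ai_alg" and S :: "'a ai_alg"
  assumes A: "ai_semiring A" and S: "S \<in> ai_models A" and "large_universe TYPE('a) TYPE('u)"
  shows "\<exists>T \<in> (variety A :: 'u ai_alg set). ai_iso T S"
proof -
  obtain e :: "(('a \<Rightarrow> nat) \<Rightarrow> nat) \<Rightarrow> 'u" where e: "inj e"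
    using assms(3) by (auto simp: large_universe_def)
  define P where "P = {\<rho> :: 'a \<Rightarrow> nat. range \<rho> \<subseteq> carrier A}"
  obtain T :: "'u ai_alg" and pr where T: "T \<in> variety A"
    and pr: "\<forall>\<rho>\<in>P. pr \<rho> \<in> ai_hom T A"
    and ex: "\<forall>f\<in>P \<rightarrow> carrier A. \<exists>x\<in>carrier T. \<forall>\<rho>\<in>P. pr \<rho> x = f \<rho>"
    by (rule power_in_variety[OF A e, folded P_def])
  have "\<exists>x\<in>carrier T. \<forall>\<rho>\<in>P. pr \<rho> x = \<rho> s" for s
    by (rule ex[rule_format]) (auto simp: P_def)
  then obtain p where p: "\<And>s. p s \<in> carrier T" "\<And>s \<rho>. \<rho> \<in> P \<Longrightarrow> pr \<rho> (p s) = \<rho> s"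
    by metis
  have algT: "ai_algebra T"
    using T variety_subset_ai_models[OF A] by (auto simp: ai_models_def)
  have algS: "ai_algebra S" and satS: "\<And>u v. sat_eq A u v \<Longrightarrow> sat_eq S u v"
    using S by (auto simp: ai_models_def)
  let ?f = "\<lambda>\<sigma> t. ai_eval T (p \<circ> \<sigma>) t"
  have fT: "?f \<sigma> t \<in> carrier T" for \<sigma> :: "nat \<Rightarrow> 'a" and t
    by (rule ai_eval_closed[OF algT]) (auto simp: p)
  have pr_eval: "pr \<rho> (?f \<sigma> t) = ai_eval A (\<rho> \<circ> \<sigma>) t" if "\<rho> \<in> P" for \<rho> \<sigma> t
  proof -
    have "pr \<rho> \<circ> (p \<circ> \<sigma>) = \<rho> \<circ> \<sigma>" using p(2)[OF that] by auto
    then show ?thesis using ai_eval_hom[OF pr[rule_format, OF that] algT, of "p \<circ> \<sigma>" t] p(1) by auto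
  qed
  \<comment> \<open>\<open>H\<close> will be well defined: a map \<open>\<theta>\<close> of the names to \<open>A\<close> composed with the naming \<open>c\<close> is an
    index of the power, so equality there says that the renamed terms form an identity of \<open>A\<close>.\<close>
  have eq: "ai_eval S \<sigma> t = ai_eval S \<sigma>' t'"
    if \<sigma>: "range \<sigma> \<subseteq> carrier S" and \<sigma>': "range \<sigma>' \<subseteq> carrier S" and f: "?f \<sigma> t = ?f \<sigma>' t'"
    for \<sigma> \<sigma>' t t'
  proof -
    obtain \<tau> :: "nat \<Rightarrow> 'a" and c where \<tau>: "range \<tau> \<subseteq> carrier S" and c: "\<forall>i\<in>ai_vars t. \<tau> (c (\<sigma> i)) = \<sigma> i"
      "\<forall>i\<in>ai_vars t'. \<tau> (c (\<sigma>' i)) = \<sigma>' i"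
      by (rule common_assignment[OF \<sigma> \<sigma>', where t = t and t' = t'])
    have "sat_eq A (ai_rename (c \<circ> \<sigma>) t) (ai_rename (c \<circ> \<sigma>') t')"
      unfolding sat_eq_def
    proof (intro allI impI)
      fix \<theta> :: "nat \<Rightarrow> nat" assume "range \<theta> \<subseteq> carrier A"
      then have "\<theta> \<circ> c \<in> P" by (auto simp: P_def)
      then show "ai_eval A \<theta> (ai_rename (c \<circ> \<sigma>) t) = ai_eval A \<theta> (ai_rename (c \<circ> \<sigma>') t')"
        using pr_eval[of "\<theta> \<circ> c" \<sigma> t] pr_eval[of "\<theta> \<circ> c" \<sigma>' t'] f by (simp add: ai_eval_rename o_assoc)
    qed
    from satS[OF this] have "ai_eval S (\<tau> \<circ> (c \<circ> \<sigma>)) t = ai_eval S (\<tau> \<circ> (c \<circ> \<sigma>')) t'"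
      using \<tau> by (simp add: sat_eq_def ai_eval_rename)
    moreover have "ai_eval S (\<tau> \<circ> (c \<circ> \<sigma>)) t = ai_eval S \<sigma> t"
      by (rule ai_eval_cong) (simp add: c)
    moreover have "ai_eval S (\<tau> \<circ> (c \<circ> \<sigma>')) t' = ai_eval S \<sigma>' t'"
      by (rule ai_eval_cong) (simp add: c)
    ultimately show ?thesis by simp
  qed
  define B where "B = {?f \<sigma> t | \<sigma> t. range \<sigma> \<subseteq> carrier S}"
  define H where "H x = (SOME a. \<exists>\<sigma> t. range \<sigma> \<subseteq> carrier S \<and> x = ?f \<sigma> t \<and> a = ai_eval S \<sigma> t)" for x
  have H: "H (?f \<sigma> t) = ai_eval S \<sigma> t" if "range \<sigma> \<subseteq> carrier S" for \<sigma> t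
    unfolding H_def
  proof (rule some_equality)
    show "\<exists>\<sigma>' t'. range \<sigma>' \<subseteq> carrier S \<and> ?f \<sigma> t = ?f \<sigma>' t' \<and> ai_eval S \<sigma> t = ai_eval S \<sigma>' t'"
      by (rule exI[of _ \<sigma>], rule exI[of _ t]) (simp add: that)
    fix a assume "\<exists>\<sigma>' t'. range \<sigma>' \<subseteq> carrier S \<and> ?f \<sigma> t = ?f \<sigma>' t' \<and> a = ai_eval S \<sigma>' t'"
    then obtain \<sigma>' t' where "range \<sigma>' \<subseteq> carrier S" "?f \<sigma> t = ?f \<sigma>' t'" "a = ai_eval S \<sigma>' t'"
      by blast
    then show "a = ai_eval S \<sigma> t" using eq[OF that, of \<sigma>' t t'] by simp
  qed
  have joint: "\<exists>\<tau> u v. range \<tau> \<subseteq> carrier S \<and> x = ?f \<tau> u \<and> y = ?f \<tau> v"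
    if xy: "x \<in> B" "y \<in> B" for x y
  proof -
    obtain \<sigma> t \<sigma>' t' where \<sigma>: "range \<sigma> \<subseteq> carrier S" "range \<sigma>' \<subseteq> carrier S"
      and f: "x = ?f \<sigma> t" "y = ?f \<sigma>' t'"
      using xy by (auto simp: B_def)
    obtain \<tau> :: "nat \<Rightarrow> 'a" and c where \<tau>: "range \<tau> \<subseteq> carrier S" and c: "\<forall>i\<in>ai_vars t. \<tau> (c (\<sigma> i)) = \<sigma> i"
      "\<forall>i\<in>ai_vars t'. \<tau> (c (\<sigma>' i)) = \<sigma>' i"
      by (rule common_assignment[OF \<sigma>, where t = t and t' = t'])
    have "x = ?f \<tau> (ai_rename (c \<circ> \<sigma>) t)" "y = ?f \<tau> (ai_rename (c \<circ> \<sigma>') t')"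
      unfolding f ai_eval_rename by (auto intro!: ai_eval_cong simp: c)
    then show ?thesis using \<tau> by blast
  qed
  have closed: "ai_add T x y \<in> B \<and> ai_mult T x y \<in> B \<and>
      H (ai_add T x y) = ai_add S (H x) (H y) \<and> H (ai_mult T x y) = ai_mult S (H x) (H y)"
    if xy: "x \<in> B" "y \<in> B" for x y
  proof -
    obtain \<tau> u v where \<tau>: "range \<tau> \<subseteq> carrier S" and x: "x = ?f \<tau> u" and y: "y = ?f \<tau> v"
      using joint[OF xy] by blast
    have xy': "ai_add T x y = ?f \<tau> (Add u v)" "ai_mult T x y = ?f \<tau> (Mult u v)"
      by (simp_all add: x y)
    have "ai_add T x y \<in> B" "ai_mult T x y \<in> B"
      unfolding xy' B_def using \<tau> by blast+
    moreover have "H (ai_add T x y) = ai_add S (H x) (H y)" "H (ai_mult T x y) = ai_mult S (H x) (H y)"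
      unfolding xy' unfolding x y H[OF \<tau>] by simp_all
    ultimately show ?thesis by blast
  qed
  have const: "H (p s) = s \<and> p s \<in> B" if "s \<in> carrier S" for s
    using H[of "\<lambda>_. s" "Var 0"] that
    by (auto simp: B_def intro!: exI[of _ "\<lambda>_. s"] exI[of _ "Var 0"])
  have sub: "ai_subuniverse B T"
    unfolding ai_subuniverse_def
  proof (intro conjI ballI)
    show "B \<noteq> {}" using const algS unfolding ai_algebra_def by blast
    show "B \<subseteq> carrier T" using fT by (auto simp: B_def)
  qed (use closed in blast)+
  have HS: "H x \<in> carrier S" if "x \<in> B" for x
    using that H ai_eval_closed[OF algS] by (auto simp: B_def)
  have Hhom: "H \<in> ai_hom (T\<lparr>carrier := B\<rparr>) S"
    using HS closed by (auto simp: ai_hom_def)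
  have Him: "H ` B = carrier S" using HS const by (force simp: image_iff)
  \<comment> \<open>\<open>S\<close> itself lives over \<open>'a\<close>; a copy over \<open>'u\<close> comes from evaluating assignments at a point.\<close>
  define d where "d s = e (\<lambda>\<rho>. \<rho> s)" for s :: 'a
  have d: "inj_on d (carrier S)"
  proof (rule inj_onI)
    fix s s' assume "d s = d s'"
    then have "(\<lambda>\<rho> :: 'a \<Rightarrow> nat. \<rho> s) = (\<lambda>\<rho>. \<rho> s')" using e by (simp add: d_def inj_eq)
    from fun_cong[OF this, of "\<lambda>r. if r = s then 1 else 0"] show "s = s'" by (auto split: if_splits)
  qed
  have "ai_transport d S \<in> variety A"
    by (rule variety_hom_image[OF variety_sub[OF T sub] ai_hom_comp[OF Hhom ai_transport_hom[OF d]]])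
      (simp add: carrier_ai_transport Him[symmetric] image_image)
  then show ?thesis using ai_iso_transport_sym[OF d algS] by blast
qed

corollary birkhoff_ai_variety:
  fixes A :: "nat ai_alg" and S :: "'a ai_alg"
  assumes "ai_semiring A" "large_universe TYPE('a) TYPE('u)"
  shows "(\<exists>T \<in> (variety A :: 'u ai_alg set). ai_iso T S) \<longleftrightarrow> S \<in> ai_models A"
  using ai_model_in_variety[OF assms(1) _ assms(2)] variety_subset_ai_models[OF assms(1)]
    ai_models_iso by blast

section \<open>The order of an ai-semiring and the monomials of a term\<close>

definition ai_le :: "'a ai_alg \<Rightarrow> 'a \<Rightarrow> 'a \<Rightarrow> bool" where
  "ai_le S a b \<longleftrightarrow> ai_add S b a = b"

lemma sat_le_iff:
  "sat_le S u v \<longleftrightarrow> (\<forall>\<rho>. range \<rho> \<subseteq> carrier S \<longrightarrow> ai_le S (ai_eval S \<rho> u) (ai_eval S \<rho> v))"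
  by (auto simp: sat_le_def sat_eq_def ai_le_def)

context ai_semiring
begin

lemma le_refl: "a \<in> carrier S \<Longrightarrow> ai_le S a a"
  by (simp add: ai_le_def add_idem)

lemma le_trans:
  assumes "a \<in> carrier S" "b \<in> carrier S" "c \<in> carrier S" "ai_le S a b" "ai_le S b c"
  shows "ai_le S a c"
  using assms add_assoc[of c b a] by (simp add: ai_le_def)

lemma le_antisym: "a \<in> carrier S \<Longrightarrow> b \<in> carrier S \<Longrightarrow> ai_le S a b \<Longrightarrow> ai_le S b a \<Longrightarrow> a = b"
  using add_comm[of a b] by (simp add: ai_le_def)

lemma add_le_iff:
  assumes "a \<in> carrier S" "b \<in> carrier S" "c \<in> carrier S"
  shows "ai_le S (ai_add S a b) c \<longleftrightarrow> ai_le S a c \<and> ai_le S b c"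
proof
  have "ai_le S a (ai_add S a b)" "ai_le S b (ai_add S a b)"
    using assms add_assoc[of b a a] add_assoc[of a b b] add_comm[of a b]
    by (simp_all add: ai_le_def add_idem)
  moreover assume "ai_le S (ai_add S a b) c"
  ultimately show "ai_le S a c \<and> ai_le S b c"
    using assms le_trans add_closed by metis
next
  assume "ai_le S a c \<and> ai_le S b c"
  then show "ai_le S (ai_add S a b) c"
    using assms add_assoc[of c a b] by (simp add: ai_le_def)
qed

lemma eval_in_carrier: "range \<rho> \<subseteq> carrier S \<Longrightarrow> ai_eval S \<rho> t \<in> carrier S"
  by (rule ai_eval_closed[OF is_ai_algebra])

lemma sat_eq_iff_sat_le: "sat_eq S u v \<longleftrightarrow> sat_le S u v \<and> sat_le S v u"
  unfolding sat_le_iff using eval_in_carrier le_antisym le_refl by (metis sat_eq_def)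

end

text \<open>
  The summands left after multiplying out. They are terms, so that they can be
  evaluated by the same function.
\<close>

primrec ai_monomials :: "ai_term \<Rightarrow> ai_term set" where
  "ai_monomials (Var i) = {Var i}"
| "ai_monomials (Add u v) = ai_monomials u \<union> ai_monomials v"
| "ai_monomials (Mult u v) = {Mult p q | p q. p \<in> ai_monomials u \<and> q \<in> ai_monomials v}"

lemma ball_ai_monomials_Mult:
  "(\<forall>m\<in>ai_monomials (Mult u v). P m) \<longleftrightarrow>
    (\<forall>p\<in>ai_monomials u. \<forall>q\<in>ai_monomials v. P (Mult p q))"
  by auto

lemma ai_monomials_cases:
  assumes "m \<in> ai_monomials t"
  obtains x where "m = Var x" | x y where "m = Mult (Var x) (Var y)"
  | p q r where "m = Mult (Mult p q) r \<or> m = Mult p (Mult q r)"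
proof -
  have "(\<exists>x. m = Var x) \<or> (\<exists>x y. m = Mult (Var x) (Var y)) \<or>
      (\<exists>p q r. m = Mult (Mult p q) r \<or> m = Mult p (Mult q r))"
    using assms
  proof (induction t arbitrary: m)
    case (Mult u v)
    then obtain p q where "m = Mult p q" "p \<in> ai_monomials u" "q \<in> ai_monomials v"
      by auto
    then show ?case using Mult.IH(1)[of p] Mult.IH(2)[of q] by blast
  qed auto
  then show thesis using that by blast
qed

context comm_ai_semiring
begin

text \<open>
  Distributing a product of two sums needs a bound for one factor while the other is a parameter;
  commutativity moves the factor under consideration to the front. This is why \<open>eval_le_iff\<close> below
  is first proved with an extra factor \<open>d\<close>.
\<close>

lemma eval_mult_le_iff:
  assumes \<rho>: "range \<rho> \<subseteq> carrier S" and "c \<in> carrier S" "d \<in> carrier S"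
  shows "ai_le S (ai_mult S (ai_eval S \<rho> t) d) c \<longleftrightarrow>
    (\<forall>m\<in>ai_monomials t. ai_le S (ai_mult S (ai_eval S \<rho> m) d) c)"
  using \<open>d \<in> carrier S\<close>
proof (induction t arbitrary: d)
  case (Add u v)
  note [simp] = eval_in_carrier[OF \<rho>] \<open>d \<in> carrier S\<close> \<open>c \<in> carrier S\<close> mult_closed
  show ?case by (simp add: distrib_right add_le_iff Add.IH ball_Un)
next
  case (Mult u v)
  note [simp] = eval_in_carrier[OF \<rho>] \<open>d \<in> carrier S\<close> \<open>c \<in> carrier S\<close> mult_closed
  let ?e = "ai_eval S \<rho>"
  have swap: "ai_mult S (?e p) (ai_mult S (?e q) d) = ai_mult S (?e q) (ai_mult S (?e p) d)" for p q
    using mult_assoc[of "?e p" "?e q" d] mult_assoc[of "?e q" "?e p" d] mult_comm[of "?e p" "?e q"]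
    by simp
  have "ai_le S (ai_mult S (?e (Mult u v)) d) c \<longleftrightarrow>
      (\<forall>p\<in>ai_monomials u. ai_le S (ai_mult S (?e v) (ai_mult S (?e p) d)) c)"
    by (simp add: mult_assoc Mult.IH(1)) (simp add: swap)
  also have "\<dots> \<longleftrightarrow> (\<forall>p\<in>ai_monomials u. \<forall>q\<in>ai_monomials v.
      ai_le S (ai_mult S (?e p) (ai_mult S (?e q) d)) c)"
    by (simp add: Mult.IH(2)) (simp add: swap)
  also have "\<dots> \<longleftrightarrow> (\<forall>m\<in>ai_monomials (Mult u v). ai_le S (ai_mult S (?e m) d) c)"
    unfolding ball_ai_monomials_Mult by (simp add: mult_assoc)
  finally show ?case .
qed simp

lemma eval_le_iff:
  assumes \<rho>: "range \<rho> \<subseteq> carrier S" and "c \<in> carrier S"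
  shows "ai_le S (ai_eval S \<rho> t) c \<longleftrightarrow> (\<forall>m\<in>ai_monomials t. ai_le S (ai_eval S \<rho> m) c)"
proof (induction t)
  case (Add u v)
  then show ?case
    using eval_in_carrier[OF \<rho>] \<open>c \<in> carrier S\<close> by (simp add: add_le_iff ball_Un)
next
  case (Mult u v)
  let ?e = "ai_eval S \<rho>"
  note [simp] = eval_in_carrier[OF \<rho>] \<open>c \<in> carrier S\<close>
  have "ai_le S (?e (Mult u v)) c \<longleftrightarrow> (\<forall>p\<in>ai_monomials u. ai_le S (ai_mult S (?e v) (?e p)) c)"
    by (simp add: eval_mult_le_iff[OF \<rho>, where t = u]) (simp add: mult_comm[of _ "?e v"])
  also have "\<dots> \<longleftrightarrow> (\<forall>p\<in>ai_monomials u. \<forall>q\<in>ai_monomials v. ai_le S (ai_mult S (?e p) (?e q)) c)"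
    by (simp add: eval_mult_le_iff[OF \<rho>, where t = v]) (simp add: mult_comm)
  also have "\<dots> \<longleftrightarrow> (\<forall>m\<in>ai_monomials (Mult u v). ai_le S (?e m) c)"
    unfolding ball_ai_monomials_Mult by simp
  finally show ?case .
qed simp

end

lemma ai_monomials_foldl_Add:
  "ai_monomials (foldl Add t ts) = ai_monomials t \<union> (\<Union>u\<in>set ts. ai_monomials u)"
  by (induction ts arbitrary: t) auto

lemma ai_monomials_odd_cycle:
  assumes "n \<ge> 1"
  shows "ai_monomials (odd_cycle n) =
    insert (Mult (Var (2 * n + 1)) (Var 1)) ((\<lambda>i. Mult (Var i) (Var (i + 1))) ` {1..2 * n})"
proof -
  have "{1..2 * n} = insert 1 {2..<2 * n + 1}" using assms by auto
  then show ?thesis by (auto simp: odd_cycle_def ai_monomials_foldl_Add)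
qed

section \<open>Graphs without odd closed walks\<close>

text \<open>
  Colour a vertex by whether a walk of even length leads to it from a fixed vertex of its component.
  Walks of equal parity to the two ends of an edge would close up to an odd walk.
\<close>

lemma ex_two_colouring:
  assumes "sym G" and odd: "\<And>x n. (x, x) \<notin> G ^^ (2 * n + 1)"
  shows "\<exists>c. \<forall>x y. (x, y) \<in> G \<longrightarrow> c x \<noteq> (c y :: bool)"
proof -
  define root where "root x = (SOME r. (r, x) \<in> G\<^sup>*)" for x
  define c where "c x \<longleftrightarrow> (\<exists>n. even n \<and> (root x, x) \<in> G ^^ n)" for x
  have symp: "sym (G ^^ n)" for n
  proof (induction n)
    case (Suc n)
    show ?case
    proof (rule symI)
      fix x y assume "(x, y) \<in> G ^^ Suc n"
      then obtain z where "(x, z) \<in> G ^^ n" "(z, y) \<in> G" by auto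
      then have "(y, z) \<in> G" "(z, x) \<in> G ^^ n" using \<open>sym G\<close> Suc by (auto dest: symD)
      then show "(y, x) \<in> G ^^ Suc n" by (rule relpow_Suc_I2)
    qed
  qed (simp add: sym_Id)
  have reach: "\<exists>n. (root x, x) \<in> G ^^ n" for x
  proof -
    have "(root x, x) \<in> G\<^sup>*" unfolding root_def by (rule someI[of _ x]) simp
    then show ?thesis by (simp add: rtrancl_power)
  qed
  have "c x \<noteq> c y" if xy: "(x, y) \<in> G" for x y
  proof -
    have yx: "(y, x) \<in> G" using xy \<open>sym G\<close> by (rule symD[rotated])
    have "(\<lambda>r. (r, x) \<in> G\<^sup>*) = (\<lambda>r. (r, y) \<in> G\<^sup>*)"
      using xy yx by (auto simp: fun_eq_iff intro: rtrancl_into_rtrancl)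
    then have root: "root x = root y" by (simp add: root_def)
    have parity: "odd (m + n)" if "(root x, x) \<in> G ^^ m" "(root x, y) \<in> G ^^ n" for m n
    proof
      assume "even (m + n)"
      then obtain k where k: "m + n = 2 * k" by blast
      have "(x, root x) \<in> G ^^ m" using that(1) symp by (auto dest: symD)
      then have "(x, y) \<in> G ^^ (m + n)" using that(2) by (auto simp: relpow_add)
      then have "(x, x) \<in> G ^^ (2 * k + 1)" using yx k by auto
      then show False using odd by blast
    qed
    obtain m n where "(root x, x) \<in> G ^^ m" "(root x, y) \<in> G ^^ n"
      using reach[of x] reach[of y] root by auto
    then show ?thesis using parity root unfolding c_def by (metis odd_add)
  qed
  then show ?thesis by blast
qed

section \<open>The axioms and their consequences\<close>

locale odd_cycle_semiring = comm_ai_semiring +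
  assumes sat_square: "sat_le S (Var 0) (Mult (Var 1) (Var 1))"
    and sat_mult: "sat_le S (Var 0) (Mult (Var 0) (Var 1))"
    and sat_cube: "sat_eq S (Mult (Var 0) (Var 0)) (Mult (Mult (Var 1) (Var 2)) (Var 3))"
    and sat_sigma: "\<And>n. n \<ge> 1 \<Longrightarrow> sat_sigma S n"
begin

lemma le_square: "x \<in> carrier S \<Longrightarrow> y \<in> carrier S \<Longrightarrow> ai_le S x (ai_mult S y y)"
  using sat_eq_three[OF sat_square[unfolded sat_le_def], of x y y] by (simp add: ai_le_def)

lemma le_mult: "x \<in> carrier S \<Longrightarrow> y \<in> carrier S \<Longrightarrow> ai_le S x (ai_mult S x y)"
  using sat_eq_three[OF sat_mult[unfolded sat_le_def], of x y y] by (simp add: ai_le_def)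

lemma le_cube:
  assumes "x \<in> carrier S" "a \<in> carrier S" "b \<in> carrier S" "c \<in> carrier S"
  shows "ai_le S x (ai_mult S (ai_mult S a b) c)"
proof -
  define \<rho> where "\<rho> i = (if i = 0 then x else if i = 1 then a else if i = 2 then b else c)" for i :: nat
  have "range \<rho> \<subseteq> carrier S" using assms by (auto simp: \<rho>_def)
  then have "ai_eval S \<rho> (Mult (Var 0) (Var 0)) = ai_eval S \<rho> (Mult (Mult (Var 1) (Var 2)) (Var 3))"
    using sat_cube unfolding sat_eq_def by blast
  then have "ai_mult S x x = ai_mult S (ai_mult S a b) c"
    by (simp add: \<rho>_def)
  then show ?thesis using le_square[OF assms(1,1)] by simp
qed

lemma le_long_monomial:
  assumes "range \<sigma> \<subseteq> carrier S" "s \<in> carrier S"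
    "m = Mult (Mult p q) r \<or> m = Mult p (Mult q r)"
  shows "ai_le S s (ai_eval S \<sigma> m)"
  using assms(3) le_cube[of s "ai_eval S \<sigma> p" "ai_eval S \<sigma> q" "ai_eval S \<sigma> r"]
    eval_in_carrier[OF assms(1)] assms(2) by (auto simp: mult_assoc)

text \<open>
  The walk supplies the substitution into \<open>\<sigma>\<^sub>n\<close>; its vertices may repeat. The indices of the walk
  start at 0 and those of the cycle at 1, and \<open>n = 0\<close> is a loop, where the square takes
  over.
\<close>

lemma le_if_odd_closed_walk:
  assumes walk: "(x, x) \<in> G ^^ (2 * n + 1)"
    and G: "\<And>a b. (a, b) \<in> G \<Longrightarrow> ai_le S (ai_mult S (\<sigma> a) (\<sigma> b)) c"
    and \<sigma>: "\<And>a. \<sigma> a \<in> carrier S" and c: "c \<in> carrier S" and s: "s \<in> carrier S"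
  shows "ai_le S s c"
proof -
  obtain f where f: "f 0 = x" "f (2 * n + 1) = x" "\<And>i. i < 2 * n + 1 \<Longrightarrow> (f i, f (Suc i)) \<in> G"
    using walk unfolding relpow_fun_conv by blast
  show ?thesis
  proof (cases "n = 0")
    case True
    then have "(x, x) \<in> G" using walk by simp
    then show ?thesis
      using le_trans[OF s _ c le_square G] s \<sigma> mult_closed by blast
  next
    case False
    define \<rho> where "\<rho> i = (if i = 0 then s else \<sigma> (f (i - 1)))" for i
    have \<rho>: "range \<rho> \<subseteq> carrier S" using \<sigma> s by (auto simp: \<rho>_def)
    have "ai_le S (ai_eval S \<rho> (odd_cycle n)) c"
    proof (rule eval_le_iff[OF \<rho> c, THEN iffD2], rule ballI)
      fix m assume "m \<in> ai_monomials (odd_cycle n)"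
      then consider "m = Mult (Var (2 * n + 1)) (Var 1)"
        | i where "i \<in> {1..2 * n}" "m = Mult (Var i) (Var (i + 1))"
        using False by (auto simp: ai_monomials_odd_cycle)
      then show "ai_le S (ai_eval S \<rho> m) c"
      proof cases
        case 1
        have "(f (2 * n), f 0) \<in> G" using f(3)[of "2 * n"] f(1,2) by simp
        then show ?thesis using 1 G by (simp add: \<rho>_def)
      next
        case 2
        then have "(f (i - 1), f i) \<in> G" using f(3)[of "i - 1"] by auto
        then show ?thesis using 2 G by (simp add: \<rho>_def)
      qed
    qed
    moreover have "ai_le S (ai_eval S \<rho> (Var 0)) (ai_eval S \<rho> (odd_cycle n))"
      using sat_sigma[of n] False \<rho> by (simp add: sat_sigma_def sat_le_iff)
    ultimately show ?thesis
      using le_trans[OF s eval_in_carrier[OF \<rho>] c] by (simp add: \<rho>_def)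
  qed
qed

end

section \<open>The semiring TR6\<close>

interpretation TR6: comm_ai_semiring TR6
  by (rule comm_ai_semiring_TR6)

lemma carrier_TR6: "carrier TR6 = {1..6}"
  by (simp add: TR6_def)

lemma mult_TR6: "ai_mult TR6 a b = (if a = 2 \<and> b = 6 \<or> a = 6 \<and> b = 2 \<or> a = 4 \<and> b = 5 \<or>
      a = 5 \<and> b = 4 \<or> a = 5 \<and> b = 6 \<or> a = 6 \<and> b = 5 then 3 else 1)"
  by (simp add: TR6_def doubleton_eq_iff)

lemma TR6_le_one: "ai_le TR6 a 1"
  by (auto simp: TR6_def ai_le_def)

lemma TR6_le_three_iff: "a \<in> carrier TR6 \<Longrightarrow> ai_le TR6 a 3 \<longleftrightarrow> a \<noteq> 1"
  by (auto simp: TR6_def ai_le_def doubleton_eq_iff)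

text \<open>
  The values other than 1 are those below 3, and a sum is below 3 if and only if all summands are.
\<close>

lemma TR6_eval_ne_one_iff:
  assumes "range \<theta> \<subseteq> carrier TR6"
  shows "ai_eval TR6 \<theta> t \<noteq> 1 \<longleftrightarrow> (\<forall>m\<in>ai_monomials t. ai_eval TR6 \<theta> m \<noteq> 1)"
  using TR6.eval_le_iff[OF assms, of 3 t] TR6.eval_in_carrier[OF assms]
  by (simp add: TR6_le_three_iff) (simp add: carrier_TR6)

lemma TR6_long_product:
  "ai_mult TR6 (ai_mult TR6 a b) c = 1" "ai_mult TR6 a (ai_mult TR6 b c) = 1"
  by (auto simp: mult_TR6)

text \<open>
  Each product that is not 1 has one factor in \<open>{2, 5}\<close> and the other in \<open>{4, 6}\<close>, so a value
  other than 1 would 2-colour an odd cycle.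
\<close>

lemma TR6_odd_cycle:
  assumes \<theta>: "range \<theta> \<subseteq> carrier TR6" and n: "n \<ge> 1"
  shows "ai_eval TR6 \<theta> (odd_cycle n) = 1"
proof (rule ccontr)
  assume ne: "ai_eval TR6 \<theta> (odd_cycle n) \<noteq> 1"
  define side where "side i \<longleftrightarrow> \<theta> i = 2 \<or> \<theta> i = 5" for i
  have edge: "side i \<noteq> side k" if "Mult (Var i) (Var k) \<in> ai_monomials (odd_cycle n)" for i k
    using TR6_eval_ne_one_iff[OF \<theta>, THEN iffD1, OF ne] that
    by (fastforce simp: side_def mult_TR6 split: if_splits)
  have "side (i + 1) = (if even i then side 1 else \<not> side 1)" if "i \<le> 2 * n" for i
    using that
  proof (induction i)
    case (Suc i)
    then show ?case using edge[of "i + 1" "i + 2"] n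
      by (auto simp: ai_monomials_odd_cycle)
  qed simp
  from this[of "2 * n"] show False
    using edge[of "2 * n + 1" 1] n by (simp add: ai_monomials_odd_cycle)
qed

lemma odd_cycle_semiring_TR6: "odd_cycle_semiring TR6"
proof
  show "sat_le TR6 (Var 0) (Mult (Var 1) (Var 1))"
    using TR6_le_one by (auto simp: sat_le_iff mult_TR6)
  show "sat_le TR6 (Var 0) (Mult (Var 0) (Var 1))"
    unfolding sat_le_iff
  proof (intro allI impI)
    fix \<rho> :: "nat \<Rightarrow> nat" assume "range \<rho> \<subseteq> carrier TR6"
    then have "\<rho> 0 \<in> carrier TR6" by auto
    then show "ai_le TR6 (ai_eval TR6 \<rho> (Var 0)) (ai_eval TR6 \<rho> (Mult (Var 0) (Var 1)))"
      using TR6_le_three_iff[of "\<rho> 0"] TR6_le_one[of "\<rho> 0"] by (simp add: mult_TR6)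
  qed
  show "sat_eq TR6 (Mult (Var 0) (Var 0)) (Mult (Mult (Var 1) (Var 2)) (Var 3))"
    by (simp add: sat_eq_def TR6_long_product) (auto simp: mult_TR6)
  show "sat_sigma TR6 n" if "n \<ge> 1" for n
    using TR6_odd_cycle that TR6_le_one by (auto simp: sat_sigma_def sat_le_iff)
qed

lemma odd_cycle_semiring_if_model:
  assumes "S \<in> ai_models TR6"
  shows "odd_cycle_semiring S"
proof -
  interpret T: odd_cycle_semiring TR6 by (rule odd_cycle_semiring_TR6)
  interpret ai_semiring S by (rule ai_models_ai_semiring[OF TR6.ai_semiring_axioms assms])
  have S: "sat_eq TR6 u v \<Longrightarrow> sat_eq S u v" for u v
    using assms by (simp add: ai_models_def)
  then have S': "sat_le TR6 u v \<Longrightarrow> sat_le S u v" for u v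
    by (simp add: sat_le_def)
  show ?thesis
  proof
    fix x y assume "x \<in> carrier S" "y \<in> carrier S"
    moreover have "sat_eq S (Mult (Var 0) (Var 1)) (Mult (Var 1) (Var 0))"
      by (rule S) (auto simp: sat_eq_def TR6.mult_comm image_subset_iff)
    ultimately show "ai_mult S x y = ai_mult S y x"
      using sat_eq_three[of S _ _ x y y] by fastforce
  qed (use S S' T.sat_square T.sat_mult T.sat_cube T.sat_sigma in \<open>auto simp: sat_sigma_def\<close>)
qed

section \<open>Completeness of the axioms\<close>

text \<open>
  The graph \<open>G\<close> consists of the products of two variables among the monomials of \<open>v\<close>. Assignments
  \<open>\<theta>\<close> that keep all monomials of \<open>v\<close> away from 1 show which monomials \<open>u\<close> can have.
\<close>

lemma (in odd_cycle_semiring) sat_le_if_TR6: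
  assumes uv: "sat_le TR6 u v"
  shows "sat_le S u v"
  unfolding sat_le_iff
proof (intro allI impI)
  fix \<sigma> :: "nat \<Rightarrow> 'a" assume \<sigma>: "range \<sigma> \<subseteq> carrier S"
  let ?V = "ai_eval S \<sigma> v"
  have V: "?V \<in> carrier S" and \<sigma>': "\<sigma> a \<in> carrier S" for a
    using \<sigma> by (auto intro: eval_in_carrier)
  have below: "ai_le S (ai_eval S \<sigma> p) ?V" if "p \<in> ai_monomials v" for p
    using eval_le_iff[OF \<sigma> V] le_refl[OF V] that by blast
  define G where "G = {(x, y). Mult (Var x) (Var y) \<in> ai_monomials v \<or>
    Mult (Var y) (Var x) \<in> ai_monomials v}"
  have G: "ai_le S (ai_mult S (\<sigma> x) (\<sigma> y)) ?V" if "(x, y) \<in> G" for x y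
    using that below[of "Mult (Var x) (Var y)"] below[of "Mult (Var y) (Var x)"]
      mult_comm[of "\<sigma> x" "\<sigma> y"] \<sigma>' by (auto simp: G_def)
  have "sym G" by (auto simp: G_def sym_def)
  show "ai_le S (ai_eval S \<sigma> u) ?V"
  proof (cases "\<forall>s\<in>carrier S. ai_le S s ?V")
    case True
    then show ?thesis using eval_in_carrier[OF \<sigma>] by blast
  next
    case False
    \<comment> \<open>Since \<open>v\<close> is not greatest, long monomials and odd closed walks are excluded.\<close>
    have short: "(\<exists>x. p = Var x) \<or> (\<exists>x y. p = Mult (Var x) (Var y) \<and> (x, y) \<in> G)"
      if p: "p \<in> ai_monomials v" for p
      using p
    proof (cases rule: ai_monomials_cases)
      case (3 a b d)
      have "ai_le S s ?V" if "s \<in> carrier S" for s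
        using le_trans[OF that eval_in_carrier[OF \<sigma>] V le_long_monomial[OF \<sigma> that 3] below[OF p]] .
      then show ?thesis using False by blast
    qed (use p in \<open>auto simp: G_def\<close>)
    have "(x, x) \<notin> G ^^ (2 * n + 1)" for x n
      using le_if_odd_closed_walk[of x n G \<sigma> ?V] G \<sigma>' V False by blast
    then obtain c :: "nat \<Rightarrow> bool" where c: "\<And>x y. (x, y) \<in> G \<Longrightarrow> c x \<noteq> c y"
      using ex_two_colouring[OF \<open>sym G\<close>] by blast
    have ne: "ai_eval TR6 \<theta> m \<noteq> 1"
      if \<theta>: "range \<theta> \<subseteq> carrier TR6" and m: "m \<in> ai_monomials u"
        and L: "\<And>x. Var x \<in> ai_monomials v \<Longrightarrow> \<theta> x \<noteq> 1"
        and E: "\<And>x y. (x, y) \<in> G \<Longrightarrow> ai_mult TR6 (\<theta> x) (\<theta> y) \<noteq> 1" for \<theta> m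
    proof -
      have "ai_eval TR6 \<theta> v \<noteq> 1"
      proof (rule TR6_eval_ne_one_iff[OF \<theta>, THEN iffD2], rule ballI)
        fix p assume "p \<in> ai_monomials v"
        with short[OF this] L E show "ai_eval TR6 \<theta> p \<noteq> 1" by auto
      qed
      moreover have "ai_le TR6 (ai_eval TR6 \<theta> u) (ai_eval TR6 \<theta> v)"
        using uv \<theta> by (simp add: sat_le_iff)
      ultimately have "ai_eval TR6 \<theta> u \<noteq> 1"
        using TR6_le_one[of "ai_eval TR6 \<theta> v"] TR6.le_antisym TR6.eval_in_carrier[OF \<theta>] by metis
      then show ?thesis using m TR6_eval_ne_one_iff[OF \<theta>, THEN iffD1] by blast
    qed
    define \<theta> where "\<theta> x = (if x \<in> Domain G then if c x then 5 else 6
      else if Var x \<in> ai_monomials v then 3 else 1 :: nat)" for x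
    have ends: "x \<in> Domain G \<and> y \<in> Domain G" if "(x, y) \<in> G" for x y
      using that \<open>sym G\<close> by (auto dest: symD)
    have \<theta>: "range \<theta> \<subseteq> carrier TR6" by (auto simp: \<theta>_def carrier_TR6)
    have ne\<theta>: "ai_eval TR6 \<theta> m \<noteq> 1" if "m \<in> ai_monomials u" for m
      by (rule ne[OF \<theta> that]) (use c ends in \<open>auto simp: \<theta>_def mult_TR6\<close>)
    show ?thesis
    proof (rule eval_le_iff[OF \<sigma> V, THEN iffD2], rule ballI)
      fix m assume m: "m \<in> ai_monomials u"
      then show "ai_le S (ai_eval S \<sigma> m) ?V"
      proof (cases rule: ai_monomials_cases)
        case (1 z)
        then consider w where "(z, w) \<in> G" | "Var z \<in> ai_monomials v"
          using ne\<theta>[OF m] by (auto simp: \<theta>_def split: if_splits)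
        then show ?thesis
        proof cases
          case 1
          show ?thesis
            using le_trans[OF \<sigma>' mult_closed[OF \<sigma>' \<sigma>'] V le_mult[OF \<sigma>' \<sigma>'] G[OF 1]] \<open>m = Var z\<close>
            by simp
        next
          case 2
          then show ?thesis using below[OF 2] \<open>m = Var z\<close> by simp
        qed
      next
        case (3 p q r)
        then show ?thesis using ne\<theta>[OF m] by (auto simp: TR6_long_product)
      next
        case (2 y z)
        \<comment> \<open>The values 1 and 3 give only products equal to 1, so both variables are vertices, of
          different colours.\<close>
        have yz: "{\<theta> y, \<theta> z} = {5, 6}"
          using ne\<theta>[OF m] 2 by (auto simp: \<theta>_def mult_TR6 split: if_splits)
        have "(y, z) \<in> G"
        proof (rule ccontr)
          assume not: "(y, z) \<notin> G"
          \<comment> \<open>2 and 4 replace 5 and 6: their products with 6 and 5 are 3 as before, and only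
            the product of 2 and 4 is 1.\<close>
          define \<theta>' where "\<theta>' x = (if x = y \<or> x = z then if \<theta> x = 5 then 2 else 4 else \<theta> x)" for x
          have "range \<theta>' \<subseteq> carrier TR6" using \<theta> by (auto simp: \<theta>'_def carrier_TR6)
          then have "ai_eval TR6 \<theta>' m \<noteq> 1"
          proof (rule ne[OF _ m])
            show "\<theta>' x \<noteq> 1" if "Var x \<in> ai_monomials v" for x
              using that by (auto simp: \<theta>'_def \<theta>_def)
            fix a b assume ab: "(a, b) \<in> G"
            have "(b, a) \<in> G" using ab \<open>sym G\<close> by (auto dest: symD)
            then have "(a, b) \<noteq> (y, z)" "(a, b) \<noteq> (z, y)" using ab not by auto
            moreover have "{\<theta> a, \<theta> b} = {5, 6}" using c[OF ab] ends[OF ab] by (auto simp: \<theta>_def)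
            ultimately show "ai_mult TR6 (\<theta>' a) (\<theta>' b) \<noteq> 1"
              using yz by (auto simp: \<theta>'_def mult_TR6 doubleton_eq_iff)
          qed
          then show False
            using 2 yz by (auto simp: \<theta>'_def mult_TR6 doubleton_eq_iff)
        qed
        then show ?thesis using 2 G by simp
      qed
    qed
  qed
qed

lemma ai_models_TR6_iff: "S \<in> ai_models TR6 \<longleftrightarrow> odd_cycle_semiring S"
proof
  assume "odd_cycle_semiring S"
  then interpret odd_cycle_semiring S .
  show "S \<in> ai_models TR6"
    using is_ai_algebra sat_le_if_TR6 by (simp add: ai_models_def sat_eq_iff_sat_le TR6.sat_eq_iff_sat_le)
qed (rule odd_cycle_semiring_if_model)

theorem proposition3p5:
  fixes S :: "'a ai_alg"
  assumes "large_universe TYPE('a) TYPE('u)"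
  shows "(\<exists>T \<in> (variety TR6 :: 'u ai_alg set). ai_iso T S) \<longleftrightarrow>
    comm_ai_semiring S \<and>
    sat_le S (Var 0) (Mult (Var 1) (Var 1)) \<and>
    sat_le S (Var 0) (Mult (Var 0) (Var 1)) \<and>
    sat_eq S (Mult (Var 0) (Var 0)) (Mult (Mult (Var 1) (Var 2)) (Var 3)) \<and>
    (\<forall>n\<ge>1. sat_sigma S n)"
  unfolding birkhoff_ai_variety[OF TR6.ai_semiring_axioms assms] ai_models_TR6_iff
  by (auto simp: odd_cycle_semiring_def odd_cycle_semiring_axioms_def)

end
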